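(* Consider the MSGD process $(X_n,V_n)_{n\in\mathbb N_0}$ of the context with constant step-sizes $\gamma_n\equiv\gamma>0$. Let $L>0$, $\sigma\ge0$, let $\mathcal D\subset\mathbb R^d$ be open with $|\nabla f(x)|^2\ge2Lf(x)$ for all $x\in\mathcal D$, let $\mathbb A_n=\{X_i\in\mathcal D\text{ for all }i=0,\dots,n\}$ for $n\in\mathbb N_0$, and assume that $\mathbb E[|D_{n+1}|^2\mid\mathcal F_n]\le\sigma f(X_n)$ on $\mathbb A_n$ for all $n\in\mathbb N_0$. Let $a,b\ge0$ and assume that \begin{align*} 0\ge{}&-1+\gamma\Bigl(\tfrac b2-a\Bigr)+\gamma^2C_L+\gamma^3\tfrac{C_La}{2},\\ 0\ge{}&a\mu+ab-a^2-2L+\gamma\Bigl(\tfrac{b\sigma}{2}+a(2C_L-\mu b+\mu a)-2L\bigl(a-\tfrac b2\bigr)\Bigr)\\ &+\gamma^2C_L\bigl(\sigma+a^2-2a\mu+2L\bigr)+\gamma^3C_La\Bigl(\tfrac\sigma2-a\mu+L\Bigr),\\ 0\ge{}&C_L-\tfrac b2(\mu+a-b)+\gamma\Bigl(\tfrac{b\mu^2}{2}+\tfrac{C_La}{2}-2C_L\mu+\tfrac{ba\mu}{2}-\tfrac{b^2\mu}{2}+C_Lb\Bigr)\\ &+\gamma^2C_L\Bigl(\mu^2-a\mu+\tfrac{ba}{2}-b\mu\Bigr)+\gamma^3\tfrac{C_La\mu}{2}(\mu-b),\\ 0\le{}&\delta:=1+\gamma(a-\mu-b)+\gamma^2(b\mu-a\mu-2C_L)+\gamma^3(2C_L\mu-C_La)+\gamma^4C_La\mu,\\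 &ab\ge C_L,\qquad \gamma\le\tfrac{b}{C_L}. \end{align*} Then there exists a constant $C\ge0$ such that for all $n\in\mathbb N$ $$\mathbb E[\mathbf 1_{\mathbb A_{n-1}}f(X_n)]\le\begin{cases}C(1+a\gamma)^{-n},&\text{if }1+a\gamma<\delta^{-1},\\C\delta^n,&\text{if }1+a\gamma>\delta^{-1},\\C(1+a\gamma)^{-n}n,&\text{if }1+a\gamma=\delta^{-1}.\end{cases}$$
   Context: Setting. $f:\mathbb R^d\to\mathbb R$ is differentiable with $C_L$-Lipschitz continuous gradient for some constant $C_L\ge0$, and $\inf_{x\in\mathbb R^d}f(x)=0$. On a filtered probability space $(\Omega,(\mathcal F_n)_{n\in\mathbb N_0},\mathcal F,\mathbb P)$, $(X_n)_{n\in\mathbb N_0}$ and $(V_n)_{n\in\mathbb N_0}$ are $(\mathcal F_n)$-adapted $\mathbb R^d$-valued processes satisfying, for all $n\in\mathbb N_0$, $$X_{n+1}=X_n+\gamma_{n+1}V_{n+1},\qquad V_{n+1}=V_n-\gamma_{n+1}\mu V_n-\gamma_{n+1}\nabla f(X_n)+\gamma_{n+1}D_{n+1},$$ where $X_0,V_0\in L^2(\Omega,\mathcal F_0)$, $(\gamma_n)_{n\in\mathbb N}$ are strictly positive reals, $\mu>0$, and $(D_n)_{n\in\mathbb N}$ is a sequence of $L^2$-martingale differences with respect to $(\mathcal F_n)$ (i.e. $D_n$ is $\mathcal F_n$-measurable, square integrable and $\mathbb E[D_{n+1}\mid\mathcal F_n]=0$). Conventions: $\delta^{-1}=+\infty$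 if $\delta=0$; the condition $\gamma\le b/C_L$ is read as $\gamma C_L\le b$. *)

theory Defs
  imports "HOL-Probability.Probability"
begin

text \<open>
  Momentum stochastic gradient descent. The objective is \<open>f\<close>, its gradient field is \<open>g\<close>.
  The library has conditional expectations of real random variables only, so the
  martingale difference property of the vector-valued noise is stated coordinatewise.
  The index \<open>0\<close> of the step-sizes and of the noise is not used. Identities between random
  variables hold almost surely.
\<close>

locale msgd = prob_space M + filtration "space M" F
  for M :: "'a measure" and F :: "nat \<Rightarrow> 'a measure" +
  fixes f :: "real ^ 'd \<Rightarrow> real"
    and g :: "real ^ 'd \<Rightarrow> real ^ 'd"
    and C\<^sub>L \<mu> :: real
    and \<gamma> :: "nat \<Rightarrow> real"
    and X V D :: "nat \<Rightarrow> 'a \<Rightarrow> real ^ 'd"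
  assumes gradient: "\<And>x. GDERIV f x :> g x"
    and lipschitz_gradient: "C\<^sub>L-lipschitz_on UNIV g"
    and f_bdd_below: "bdd_below (range f)"
    and f_inf: "(INF x. f x) = 0"
    and subalg: "\<And>n. subalgebra M (F n)"
    and mu_pos: "\<mu> > 0"
    and step_pos: "\<And>n. \<gamma> (Suc n) > 0"
    and X_adapted: "\<And>n. X n \<in> borel_measurable (F n)"
    and V_adapted: "\<And>n. V n \<in> borel_measurable (F n)"
    and X0_L2: "integrable M (\<lambda>\<omega>. (norm (X 0 \<omega>))\<^sup>2)"
    and V0_L2: "integrable M (\<lambda>\<omega>. (norm (V 0 \<omega>))\<^sup>2)"
    and D_adapted: "\<And>n. D (Suc n) \<in> borel_measurable (F (Suc n))"
    and D_L2: "\<And>n. integrable M (\<lambda>\<omega>. (norm (D (Suc n) \<omega>))\<^sup>2)"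
    and D_martingale_difference:
      "\<And>n i. AE \<omega> in M. real_cond_exp M (F n) (\<lambda>\<omega>. D (Suc n) \<omega> $ i) \<omega> = 0"
    and X_step: "\<And>n. AE \<omega> in M. X (Suc n) \<omega> = X n \<omega> + \<gamma> (Suc n) *\<^sub>R V (Suc n) \<omega>"
    and V_step: "\<And>n. AE \<omega> in M. V (Suc n) \<omega> =
      V n \<omega> - (\<gamma> (Suc n) * \<mu>) *\<^sub>R V n \<omega> - \<gamma> (Suc n) *\<^sub>R g (X n \<omega>)
        + \<gamma> (Suc n) *\<^sub>R D (Suc n) \<omega>"

definition stay_event :: "'a measure \<Rightarrow> (nat \<Rightarrow> 'a \<Rightarrow> 'b) \<Rightarrow> 'b set \<Rightarrow> nat \<Rightarrow> 'a set" where
  "stay_event M X U n = {\<omega> \<in> space M. \<forall>i\<le>n. X i \<omega> \<in> U}"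

end

theory Submission
  imports Defs
begin

text \<open>
  The Lyapunov function is the energy
  \<open>E\<^sub>n = a f(X\<^sub>n) + \<langle>\<nabla>f(X\<^sub>n), V\<^sub>n\<rangle> + b/2 |V\<^sub>n|\<^sup>2\<close>, which is nonnegative because \<open>ab \<ge> C\<^sub>L\<close>.
  Expanding \<open>E\<close> at time \<open>n+1\<close> around \<open>X\<^sub>n\<close> and conditioning on \<open>F\<^sub>n\<close>, the three polynomial conditions
  say that the coefficients of \<open>|\<nabla>f(X\<^sub>n)|\<^sup>2\<close>, \<open>f(X\<^sub>n)\<close> and \<open>|V\<^sub>n|\<^sup>2\<close> are dominated by those of \<open>\<delta> E\<^sub>n\<close>,
  while the coefficients of \<open>\<langle>\<nabla>f(X\<^sub>n), V\<^sub>n\<rangle>\<close> agree. Hence the expected energy on the stay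
  events decays like \<open>\<delta>\<^sup>n\<close>. Expanding \<open>f(X\<^sub>n)\<close> around the next iterate \<open>x\<close>, with energy \<open>E\<close>, gives
  \<open>(1 + a\<gamma>) f(x) \<le> f(X\<^sub>n) + \<gamma> E\<close> because \<open>\<gamma> C\<^sub>L \<le> b\<close>, and the claim follows
  from the resulting linear recursion perturbed by a geometric term.
\<close>

section \<open>Smoothness inequalities and nonnegativity of the energy\<close>

text \<open>Along the segment, \<open>\<phi>\<close> is f minus the non-constant part of its
  quadratic model. Its derivative is nonpositive for t \<ge> 0, because Cauchy-Schwarz and the
  Lipschitz bound give \<open>inner d (g (x + t *\<^sub>R d) - g x) \<le> C * t * (norm
  d)\<^sup>2\<close>. Comparing t = 1 with t = 0 is the claim.\<close>

lemma descent_lemma: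
  fixes f :: "'b::real_inner \<Rightarrow> real"
  assumes grad: "\<And>z. GDERIV f z :> g z" and lip: "C-lipschitz_on UNIV g"
  shows "f (x + d) \<le> f x + inner (g x) d + C / 2 * (norm d)\<^sup>2"
proof -
  define \<phi> where "\<phi> t = f (x + t *\<^sub>R d) - t * inner (g x) d - C / 2 * t\<^sup>2 * (norm d)\<^sup>2" for t :: real
  define \<phi>' where "\<phi>' t = inner d (g (x + t *\<^sub>R d)) - inner (g x) d - C * t * (norm d)\<^sup>2" for t :: real
  have deriv: "(\<phi> has_real_derivative \<phi>' t) (at t)" for t
  proof -
    have "(f has_derivative (\<lambda>h. inner h (g (x + t *\<^sub>R d)))) (at (x + t *\<^sub>R d))"
      using grad by (simp add: gderiv_def)
    then have "((\<lambda>t. f (x + t *\<^sub>R d)) has_derivative (\<lambda>s. inner (s *\<^sub>R d) (g (x + t *\<^sub>R d)))) (at t)"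
      by (rule has_derivative_compose [rotated]) (auto intro!: derivative_eq_intros)
    then have "((\<lambda>t. f (x + t *\<^sub>R d)) has_real_derivative inner d (g (x + t *\<^sub>R d))) (at t)"
      by (simp add: has_field_derivative_def mult_commute_abs)
    then show ?thesis
      unfolding \<phi>_def \<phi>'_def by (auto intro!: derivative_eq_intros)
  qed
  have nonpos: "\<phi>' t \<le> 0" if "0 \<le> t" for t
  proof -
    have "norm (g (x + t *\<^sub>R d) - g x) \<le> C * norm (t *\<^sub>R d)"
      using lipschitz_onD [OF lip, of "x + t *\<^sub>R d" x] by (simp add: dist_norm)
    then have "norm d * norm (g (x + t *\<^sub>R d) - g x) \<le> norm d * (C * (t * norm d))"
      using that by (intro mult_left_mono) auto
    moreover have "inner d (g (x + t *\<^sub>R d) - g x) \<le> norm d * norm (g (x + t *\<^sub>R d) - g x)"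
      by (rule norm_cauchy_schwarz)
    ultimately show ?thesis
      by (simp add: \<phi>'_def inner_diff_right inner_commute power2_eq_square algebra_simps)
  qed
  have "\<phi> 1 \<le> \<phi> 0"
    by (rule DERIV_nonpos_imp_nonincreasing) (use deriv nonpos in auto)
  then show ?thesis
    by (simp add: \<phi>_def)
qed

text \<open>This is the descent lemma for the negated function, started at \<open>x + d\<close> with
  displacement \<open>- d\<close>. The gradient is then taken at the new point, as in the energy of
  the next iterate.\<close>

lemma descent_lemma_reverse:
  fixes f :: "'b::real_inner \<Rightarrow> real"
  assumes grad: "\<And>z. GDERIV f z :> g z" and lip: "C-lipschitz_on UNIV g"
  shows "f (x + d) \<le> f x + inner (g (x + d)) d + C / 2 * (norm d)\<^sup>2"
proof -
  have "GDERIV (\<lambda>z. - f z) z :> - g z" for z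
    using grad by (rule GDERIV_minus)
  moreover have "C-lipschitz_on UNIV (\<lambda>z. - g z)"
    using lip by simp
  ultimately show ?thesis
    using descent_lemma [of "\<lambda>z. - f z" "\<lambda>z. - g z" C "x + d" "- d"] by simp
qed

text \<open>Nonnegativity of f at \<open>x + t *\<^sub>R v\<close> turns the descent lemma into a
  polynomial in t that is nonnegative for all real t. For positive \<open>a\<close>, its value at t
  = 1/a, multiplied by \<open>a\<close>, is the energy with \<open>C / a\<close> in place of
  \<open>b\<close>, and \<open>C / a \<le> b\<close>.\<close>

lemma energy_nonneg:
  fixes f :: "'b::real_inner \<Rightarrow> real"
  assumes grad: "\<And>z. GDERIV f z :> g z" and lip: "C-lipschitz_on UNIV g"
    and f_nonneg: "\<And>z. 0 \<le> f z" and a: "0 \<le> a" and b: "0 \<le> b" and ab: "C \<le> a * b"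
  shows "0 \<le> a * f x + inner (g x) v + b / 2 * (norm v)\<^sup>2"
proof -
  have C: "0 \<le> C" using lip by (rule lipschitz_on_nonneg)
  have pos: "0 \<le> f x + t * inner (g x) v + C / 2 * t\<^sup>2 * (norm v)\<^sup>2" for t
    using descent_lemma [OF grad lip, of x "t *\<^sub>R v"] f_nonneg [of "x + t *\<^sub>R v"]
    by (simp add: power_mult_distrib)
  show ?thesis
  proof (cases "a = 0")
    case True
    \<comment> \<open>Now the polynomial \<open>pos\<close> is affine in t and nonnegative on the
      whole line. If its slope were negative, the t chosen below would give the value -1.\<close>
    with ab C have "C = 0" by simp
    have "0 \<le> inner (g x) v"
    proof (rule ccontr)
      assume "\<not> ?thesis"
      then have "(f x + 1) / - inner (g x) v * inner (g x) v = - (f x + 1)"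
        by (simp add: field_simps)
      then show False
        using pos [of "(f x + 1) / - inner (g x) v"] \<open>C = 0\<close> by simp
    qed
    with True b show ?thesis by simp
  next
    case False
    with a have a: "0 < a" by simp
    have "0 \<le> a * (f x + 1 / a * inner (g x) v + C / 2 * (1 / a)\<^sup>2 * (norm v)\<^sup>2)"
      by (rule mult_nonneg_nonneg [OF less_imp_le [OF a] pos])
    also have "\<dots> = a * f x + inner (g x) v + C / a / 2 * (norm v)\<^sup>2"
      using a by (simp add: field_simps power2_eq_square)
    also have "\<dots> \<le> a * f x + inner (g x) v + b / 2 * (norm v)\<^sup>2"
      using ab a by (intro add_left_mono mult_right_mono) (auto simp: field_simps)
    finally show ?thesis .
  qed
qed

section \<open>A linear recursion with a geometric perturbation\<close>

text \<open>Unrolling the recursion produces \<open>q ^ n\<close> times a geometric sum of ratio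
  \<delta>/q. The three cases are a ratio below, equal to or above 1; each is checked by induction
  from n = 1 with an explicit constant.\<close>

lemma perturbed_geometric_decay:
  fixes q \<delta> c :: real and u :: "nat \<Rightarrow> real"
  assumes q: "0 < q" and \<delta>: "0 \<le> \<delta>" and c: "0 \<le> c"
    and u_nonneg: "0 \<le> u 1"
    and step: "\<And>n. n \<ge> 1 \<Longrightarrow> u (Suc n) \<le> q * (u n + c * \<delta> ^ n)"
  shows "\<exists>C\<ge>0. \<forall>n\<ge>1. (\<delta> < q \<longrightarrow> u n \<le> C * q ^ n) \<and> (q < \<delta> \<longrightarrow> u n \<le> C * \<delta> ^ n)
    \<and> (\<delta> = q \<longrightarrow> u n \<le> C * q ^ n * real n)"
proof (cases \<delta> q rule: linorder_cases)
  case less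
  \<comment> \<open>The sequence \<open>- \<beta> * \<delta> ^ n\<close> solves the recursion with
    equality. Keeping this term in the induction hypothesis leaves a purely geometric remainder, and
    \<open>C\<close> is fitted to equality at n = 1.\<close>
  define \<beta> where "\<beta> = q * c / (q - \<delta>)"
  have \<beta>: "0 \<le> \<beta>" "q * \<beta> = \<beta> * \<delta> + q * c"
    using less q c by (auto simp: \<beta>_def field_simps)
  define C where "C = (u 1 + \<beta> * \<delta>) / q"
  have "0 \<le> C" using q \<beta> \<delta> u_nonneg by (simp add: C_def)
  moreover have "u n \<le> C * q ^ n - \<beta> * \<delta> ^ n" if "n \<ge> 1" for n
    using that
  proof (induction n rule: nat_induct_at_least)
    case base
    show ?case using q by (simp add: C_def)
  next
    case (Suc n)
    have "u (Suc n) \<le> q * (u n + c * \<delta> ^ n)"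
      using Suc.hyps by (rule step)
    also have "\<dots> \<le> q * (C * q ^ n - \<beta> * \<delta> ^ n + c * \<delta> ^ n)"
      using Suc.IH q by simp
    also have "\<dots> = C * q ^ Suc n - (q * \<beta> - q * c) * \<delta> ^ n"
      by (simp add: algebra_simps)
    also have "\<dots> = C * q ^ Suc n - \<beta> * \<delta> ^ Suc n"
      by (simp add: \<beta>)
    finally show ?case .
  qed
  then have "u n \<le> C * q ^ n" if "n \<ge> 1" for n
    using that \<beta>(1) \<delta> by (smt (verit) mult_nonneg_nonneg zero_le_power)
  ultimately show ?thesis using less by (intro exI [of _ C]) auto
next
  case equal
  \<comment> \<open>In the resonant case each step adds one more term of size at most
    \<open>C * q ^ Suc n\<close>, whence the factor n. The first entry of the maximum serves the
    induction step, the second the base case.\<close>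
  define C where "C = max c (u 1 / q)"
  have C: "0 \<le> C" "c \<le> C" "u 1 / q \<le> C" using c by (auto simp: C_def)
  have "u n \<le> C * q ^ n * real n" if "n \<ge> 1" for n
    using that
  proof (induction n rule: nat_induct_at_least)
    case base
    show ?case using q C by (simp add: field_simps)
  next
    case (Suc n)
    have "u (Suc n) \<le> q * (u n + c * q ^ n)"
      using step [OF Suc.hyps] equal by simp
    also have "\<dots> \<le> q * (C * q ^ n * real n + C * q ^ n)"
      using Suc.IH q C by (intro mult_left_mono add_mono mult_right_mono) auto
    also have "\<dots> = C * q ^ Suc n * real (Suc n)"
      by (simp add: algebra_simps)
    finally show ?case .
  qed
  with C equal show ?thesis by (intro exI [of _ C]) auto
next
  case greater
  \<comment> \<open>The first entry is the threshold for
    \<open>q * C + q * c \<le> C * \<delta>\<close>, which closes the induction step; the second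
    covers n = 1.\<close>
  define C where "C = max (q * c / (\<delta> - q)) (u 1 / \<delta>)"
  have C: "0 \<le> C" "q * c / (\<delta> - q) \<le> C" "u 1 / \<delta> \<le> C"
    using c q greater by (auto simp: C_def le_max_iff_disj)
  have "u n \<le> C * \<delta> ^ n" if "n \<ge> 1" for n
    using that
  proof (induction n rule: nat_induct_at_least)
    case base
    show ?case using q greater C by (simp add: field_simps)
  next
    case (Suc n)
    have "u (Suc n) \<le> q * (u n + c * \<delta> ^ n)"
      using Suc.hyps by (rule step)
    also have "\<dots> \<le> q * (C * \<delta> ^ n + c * \<delta> ^ n)"
      using Suc.IH q by simp
    also have "\<dots> = (q * C + q * c) * \<delta> ^ n"
      by (simp add: algebra_simps)
    also have "\<dots> \<le> (C * \<delta>) * \<delta> ^ n"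
      using C greater \<delta> by (intro mult_right_mono) (auto simp: field_simps)
    finally show ?case by (simp add: mult.assoc)
  qed
  with C greater show ?thesis by (intro exI [of _ C]) auto
qed

section \<open>Square-integrable random vectors\<close>

text \<open>Measurability of \<open>Y\<close> is demanded separately, since integrability of the
  squared norm does not imply it.\<close>

definition square_integrable :: "'a measure \<Rightarrow> ('a \<Rightarrow> 'b::euclidean_space) \<Rightarrow> bool" where
  "square_integrable M Y \<longleftrightarrow> Y \<in> borel_measurable M \<and> integrable M (\<lambda>\<omega>. (norm (Y \<omega>))\<^sup>2)"

lemma square_integrable_inner:
  assumes "square_integrable M Y" "square_integrable M Z"
  shows "integrable M (\<lambda>\<omega>. inner (Y \<omega>) (Z \<omega>))"
proof (rule Bochner_Integration.integrable_bound)
  show "integrable M (\<lambda>\<omega>. (norm (Y \<omega>))\<^sup>2 + (norm (Z \<omega>))\<^sup>2)"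
    using assms by (simp add: square_integrable_def)
  show "(\<lambda>\<omega>. inner (Y \<omega>) (Z \<omega>)) \<in> borel_measurable M"
    using assms by (auto simp: square_integrable_def)
  have "norm (inner y z) \<le> (norm y)\<^sup>2 + (norm z)\<^sup>2" for y z :: 'b
    using Cauchy_Schwarz_ineq2 [of y z] sum_squares_bound [of "norm y" "norm z"]
      mult_nonneg_nonneg [OF norm_ge_zero [of y] norm_ge_zero [of z]]
    by simp
  then show "AE \<omega> in M. norm (inner (Y \<omega>) (Z \<omega>)) \<le> norm ((norm (Y \<omega>))\<^sup>2 + (norm (Z \<omega>))\<^sup>2)"
    by simp
qed

lemma square_integrable_scaleR:
  "square_integrable M Y \<Longrightarrow> square_integrable M (\<lambda>\<omega>. c *\<^sub>R Y \<omega>)"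
  by (auto simp: square_integrable_def power_mult_distrib)

lemma square_integrable_add:
  assumes "square_integrable M Y" "square_integrable M Z"
  shows "square_integrable M (\<lambda>\<omega>. Y \<omega> + Z \<omega>)"
proof -
  have "integrable M (\<lambda>\<omega>. (norm (Y \<omega>))\<^sup>2 + (norm (Z \<omega>))\<^sup>2 + 2 * inner (Y \<omega>) (Z \<omega>))"
    using assms square_integrable_inner [OF assms] by (auto simp: square_integrable_def)
  moreover have "(norm (y + z))\<^sup>2 = (norm y)\<^sup>2 + (norm z)\<^sup>2 + 2 * inner y z" for y z :: 'b
    by (simp add: power2_norm_eq_inner inner_simps inner_commute)
  ultimately show ?thesis
    using assms by (auto simp: square_integrable_def)
qed

lemma square_integrable_diff:
  assumes "square_integrable M Y" "square_integrable M Z"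
  shows "square_integrable M (\<lambda>\<omega>. Y \<omega> - Z \<omega>)"
  using square_integrable_add [OF assms(1) square_integrable_scaleR [OF assms(2), of "-1"]]
  by simp

lemma square_integrable_indicator:
  assumes "square_integrable M Y" "A \<in> sets M"
  shows "square_integrable M (\<lambda>\<omega>. indicator A \<omega> *\<^sub>R Y \<omega>)"
proof -
  have "integrable M (\<lambda>\<omega>. indicator A \<omega> *\<^sub>R (norm (Y \<omega>))\<^sup>2)"
    using assms by (intro integrable_mult_indicator) (auto simp: square_integrable_def)
  moreover have "indicator A \<omega> *\<^sub>R (norm (Y \<omega>))\<^sup>2 = (norm (indicator A \<omega> *\<^sub>R Y \<omega>))\<^sup>2" for \<omega>
    by (simp add: indicator_def)
  ultimately show ?thesis
    using assms by (auto simp: square_integrable_def)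
qed

text \<open>This carries square integrability through the recursions of the process, which hold only
  almost surely. An almost sure identity does not give measurability of \<open>Z\<close>, so that is
  assumed.\<close>

lemma square_integrable_cong_AE:
  assumes "square_integrable M Y" "Z \<in> borel_measurable M" "AE \<omega> in M. Z \<omega> = Y \<omega>"
  shows "square_integrable M Z"
proof -
  have "integrable M (\<lambda>\<omega>. (norm (Y \<omega>))\<^sup>2) = integrable M (\<lambda>\<omega>. (norm (Z \<omega>))\<^sup>2)"
    using assms by (intro integrable_cong_AE) (auto simp: square_integrable_def)
  then show ?thesis using assms by (simp add: square_integrable_def)
qed

lemma (in finite_measure) square_integrable_const: "square_integrable M (\<lambda>\<omega>. c)"
  by (simp add: square_integrable_def)

text \<open>The difference \<open>h (Y \<omega>) - h 0\<close> is dominated by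
  \<open>C * norm (Y \<omega>)\<close>, and the constant \<open>h 0\<close> is square integrable
  because the measure is finite.\<close>

lemma (in finite_measure) square_integrable_lipschitz:
  assumes Y: "square_integrable M Y" and lip: "C-lipschitz_on UNIV h"
  shows "square_integrable M (\<lambda>\<omega>. h (Y \<omega>))"
proof -
  have C: "0 \<le> C" using lip by (rule lipschitz_on_nonneg)
  have "h \<in> borel_measurable borel"
    using lip by (intro borel_measurable_continuous_onI lipschitz_on_continuous_on)
  then have meas: "(\<lambda>\<omega>. h (Y \<omega>)) \<in> borel_measurable M"
    using Y by (auto simp: square_integrable_def)
  have "square_integrable M (\<lambda>\<omega>. h (Y \<omega>) - h 0)"
    unfolding square_integrable_def
  proof
    show "integrable M (\<lambda>\<omega>. (norm (h (Y \<omega>) - h 0))\<^sup>2)"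
    proof (rule Bochner_Integration.integrable_bound)
      show "integrable M (\<lambda>\<omega>. C\<^sup>2 * (norm (Y \<omega>))\<^sup>2)"
        using Y by (simp add: square_integrable_def)
      have "(norm (h y - h 0))\<^sup>2 \<le> C\<^sup>2 * (norm y)\<^sup>2" for y
        using lipschitz_onD [OF lip, of y 0]
        by (auto simp: dist_norm simp flip: power_mult_distrib intro: power_mono)
      then show "AE \<omega> in M. norm ((norm (h (Y \<omega>) - h 0))\<^sup>2) \<le> norm (C\<^sup>2 * (norm (Y \<omega>))\<^sup>2)"
        by simp
    qed (use meas in simp)
  qed (use meas in simp)
  from square_integrable_add [OF this square_integrable_const [of "h 0"]] show ?thesis
    by simp
qed

section \<open>One-step expansion of the energy\<close>

text \<open>The new velocity is \<open>m + h *\<^sub>R d\<close>, with \<open>m\<close> its part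
  before the noise \<open>d\<close>. The constant \<open>\<kappa>\<close> collects the coefficients
  of the squared new velocity: \<open>b / 2\<close> from the energy, \<open>C * h\<close> from
  moving the gradient back to \<open>x\<close>, and \<open>a * C * h\<^sup>2 / 2\<close> from the
  descent lemma. Expanding the square isolates one term linear and one quadratic in
  \<open>d\<close>.\<close>

lemma energy_step_pointwise:
  fixes f :: "'b::real_inner \<Rightarrow> real" and m d x :: 'b and a b C h :: real
  assumes grad: "\<And>z. GDERIV f z :> g z" and lip: "C-lipschitz_on UNIV g"
    and a: "0 \<le> a" and h: "0 \<le> h"
  defines "\<kappa> \<equiv> b / 2 + C * h + a * C * h\<^sup>2 / 2"
  shows "a * f (x + h *\<^sub>R (m + h *\<^sub>R d)) + inner (g (x + h *\<^sub>R (m + h *\<^sub>R d))) (m + h *\<^sub>R d)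
      + b / 2 * (norm (m + h *\<^sub>R d))\<^sup>2
    \<le> a * f x + (1 + a * h) * inner (g x) m + \<kappa> * (norm m)\<^sup>2
      + inner (((1 + a * h) * h) *\<^sub>R g x + (2 * \<kappa> * h) *\<^sub>R m) d + \<kappa> * h\<^sup>2 * (norm d)\<^sup>2"
proof -
  define w where "w = m + h *\<^sub>R d"
  have "f (x + h *\<^sub>R w) \<le> f x + h * inner (g x) w + C / 2 * (h\<^sup>2 * (norm w)\<^sup>2)"
    using descent_lemma [OF grad lip, of x "h *\<^sub>R w"] by (simp add: power_mult_distrib)
  then have 1: "a * f (x + h *\<^sub>R w) \<le> a * (f x + h * inner (g x) w + C / 2 * (h\<^sup>2 * (norm w)\<^sup>2))"
    using a by (rule mult_left_mono)
  have "norm (g (x + h *\<^sub>R w) - g x) \<le> C * (h * norm w)"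
    using lipschitz_onD [OF lip, of "x + h *\<^sub>R w" x] h by (simp add: dist_norm)
  then have "norm (g (x + h *\<^sub>R w) - g x) * norm w \<le> C * (h * norm w) * norm w"
    by (intro mult_right_mono) auto
  then have 2: "inner (g (x + h *\<^sub>R w)) w \<le> inner (g x) w + C * h * (norm w)\<^sup>2"
    using norm_cauchy_schwarz [of "g (x + h *\<^sub>R w) - g x" w]
    by (simp add: inner_diff_left power2_eq_square mult.assoc)
  have "a * f (x + h *\<^sub>R w) + inner (g (x + h *\<^sub>R w)) w + b / 2 * (norm w)\<^sup>2
    \<le> a * f x + (1 + a * h) * inner (g x) w + \<kappa> * (norm w)\<^sup>2"
    using 1 2 by (simp add: \<kappa>_def algebra_simps)
  also have "\<dots> = a * f x + (1 + a * h) * inner (g x) m + \<kappa> * (norm m)\<^sup>2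
      + inner (((1 + a * h) * h) *\<^sub>R g x + (2 * \<kappa> * h) *\<^sub>R m) d + \<kappa> * h\<^sup>2 * (norm d)\<^sup>2"
    unfolding w_def power2_norm_eq_inner
    by (simp add: inner_simps inner_commute [of d m] power2_eq_square) (simp add: algebra_simps)
  finally show ?thesis by (simp add: w_def)
qed

text \<open>The left side is the bound of \<open>energy_step_pointwise\<close> after conditioning:
  the linear noise term is gone and the noise energy is replaced by \<open>\<sigma> * y\<close>.
  Here \<open>p\<close> stands for the gradient and \<open>y\<close> for the objective value. The
  difference of the two sides is linear in \<open>y\<close>, \<open>(norm p)\<^sup>2\<close>,
  \<open>inner p v\<close> and \<open>(norm v)\<^sup>2\<close>, so the coefficients can be treated
  separately.\<close>

lemma energy_drift:
  fixes p v :: "'b::real_inner" and y :: real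
  assumes h: "0 < h" and y: "0 \<le> y" and p: "2 * L * y \<le> (norm p)\<^sup>2"
    and cond1: "0 \<ge> - 1 + h * (b / 2 - a) + h^2 * C + h^3 * (C * a / 2)"
    and cond2: "0 \<ge> a * \<mu> + a * b - a^2 - 2 * L
      + h * (b * \<sigma> / 2 + a * (2 * C - \<mu> * b + \<mu> * a) - 2 * L * (a - b / 2))
      + h^2 * C * (\<sigma> + a^2 - 2 * a * \<mu> + 2 * L)
      + h^3 * C * a * (\<sigma> / 2 - a * \<mu> + L)"
    and cond3: "0 \<ge> C - b / 2 * (\<mu> + a - b)
      + h * (b * \<mu>^2 / 2 + C * a / 2 - 2 * C * \<mu> + b * a * \<mu> / 2 - b^2 * \<mu> / 2 + C * b)
      + h^2 * C * (\<mu>^2 - a * \<mu> + b * a / 2 - b * \<mu>)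
      + h^3 * (C * a * \<mu> / 2) * (\<mu> - b)"
    and delta: "\<delta> = 1 + h * (a - \<mu> - b) + h^2 * (b * \<mu> - a * \<mu> - 2 * C)
      + h^3 * (2 * C * \<mu> - C * a) + h^4 * C * a * \<mu>"
  defines "\<kappa> \<equiv> b / 2 + C * h + a * C * h\<^sup>2 / 2" and "m \<equiv> (1 - h * \<mu>) *\<^sub>R v - h *\<^sub>R p"
  shows "a * y + (1 + a * h) * inner p m + \<kappa> * (norm m)\<^sup>2 + \<kappa> * h\<^sup>2 * (\<sigma> * y)
    \<le> \<delta> * (a * y + inner p v + b / 2 * (norm v)\<^sup>2)"
proof -
  define c1 where "c1 = - 1 + h * (b / 2 - a) + h^2 * C + h^3 * (C * a / 2)"
  define c2 where "c2 = a * \<mu> + a * b - a^2 - 2 * L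
      + h * (b * \<sigma> / 2 + a * (2 * C - \<mu> * b + \<mu> * a) - 2 * L * (a - b / 2))
      + h^2 * C * (\<sigma> + a^2 - 2 * a * \<mu> + 2 * L)
      + h^3 * C * a * (\<sigma> / 2 - a * \<mu> + L)"
  define c3 where "c3 = C - b / 2 * (\<mu> + a - b)
      + h * (b * \<mu>^2 / 2 + C * a / 2 - 2 * C * \<mu> + b * a * \<mu> / 2 - b^2 * \<mu> / 2 + C * b)
      + h^2 * C * (\<mu>^2 - a * \<mu> + b * a / 2 - b * \<mu>)
      + h^3 * (C * a * \<mu> / 2) * (\<mu> - b)"
  \<comment> \<open>The quartic polynomial \<delta> factors as this product, which is the
    coefficient of \<open>inner p v\<close> on the left side. The mixed term, whose sign is unknown,
    therefore cancels exactly.\<close>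
  have e0: "(1 - h * \<mu>) * (1 + a * h - 2 * h * \<kappa>) = \<delta>"
    unfolding delta \<kappa>_def by (simp add: field_simps eval_nat_numeral)
  have e1: "h * c1 = h\<^sup>2 * \<kappa> - h * (1 + a * h)"
    unfolding c1_def \<kappa>_def by (simp add: field_simps eval_nat_numeral)
  have e2: "h * c2 = a + \<kappa> * h\<^sup>2 * \<sigma> + 2 * L * (h * c1) - \<delta> * a"
    unfolding c1_def c2_def \<kappa>_def delta by (simp add: field_simps eval_nat_numeral)
  have e3: "h * c3 = \<kappa> * (1 - h * \<mu>)\<^sup>2 - \<delta> * b / 2"
    unfolding c3_def \<kappa>_def delta by (simp add: field_simps eval_nat_numeral)
  have pm: "inner p m = (1 - h * \<mu>) * inner p v - h * (norm p)\<^sup>2"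
    by (simp add: m_def inner_simps power2_norm_eq_inner)
  have mm: "(norm m)\<^sup>2 = (1 - h * \<mu>)\<^sup>2 * (norm v)\<^sup>2 - 2 * h * (1 - h * \<mu>) * inner p v + h\<^sup>2 * (norm p)\<^sup>2"
    unfolding power2_norm_eq_inner m_def
    by (simp add: inner_simps inner_commute [of v p] power2_eq_square) (simp add: algebra_simps)
  have "a * y + (1 + a * h) * inner p m + \<kappa> * (norm m)\<^sup>2 + \<kappa> * h\<^sup>2 * (\<sigma> * y)
      - \<delta> * (a * y + inner p v + b / 2 * (norm v)\<^sup>2)
    = (a + \<kappa> * h\<^sup>2 * \<sigma> - \<delta> * a) * y + (h\<^sup>2 * \<kappa> - h * (1 + a * h)) * (norm p)\<^sup>2
      + ((1 - h * \<mu>) * (1 + a * h - 2 * h * \<kappa>) - \<delta>) * inner p v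
      + (\<kappa> * (1 - h * \<mu>)\<^sup>2 - \<delta> * b / 2) * (norm v)\<^sup>2"
    unfolding pm mm by (simp add: algebra_simps)
  \<comment> \<open>The square \<open>(norm p)\<^sup>2\<close> is split into
    \<open>2 * L * y\<close> and a nonnegative surplus. The first part joins the coefficient of
    \<open>y\<close> and accounts for the terms with \<open>L\<close> in \<open>c2\<close>; the
    surplus keeps the nonpositive factor \<open>c1\<close>.\<close>
  also have "\<dots> = h * c2 * y + h * c1 * ((norm p)\<^sup>2 - 2 * L * y) + h * c3 * (norm v)\<^sup>2"
    unfolding e0 e1 [symmetric] e2 e3 by (simp add: algebra_simps)
  also have "\<dots> \<le> 0"
  proof -
    have "h * c * z \<le> 0" if "0 \<ge> c" "0 \<le> z" for c z
      using h that by (simp add: mult_nonneg_nonpos mult_nonpos_nonneg)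
    then show ?thesis
      using y p cond1 [folded c1_def] cond2 [folded c2_def] cond3 [folded c3_def]
      by (intro add_nonpos_nonpos) auto
  qed
  finally show ?thesis by simp
qed

section \<open>Measurability and integrability of the process\<close>

context msgd
begin

lemma lipschitz_const_nonneg: "0 \<le> C\<^sub>L"
  using lipschitz_gradient by (rule lipschitz_on_nonneg)

lemma f_nonneg: "0 \<le> f x"
  using f_inf cINF_lower [OF f_bdd_below, of x] by simp

lemma continuous_f: "continuous_on UNIV f"
  using gradient by (auto simp: gderiv_def continuous_on_eq_continuous_at intro: has_derivative_continuous)

lemma continuous_g: "continuous_on UNIV g"
  using lipschitz_gradient by (rule lipschitz_on_continuous_on)

lemma borel_measurable_filtration:
  "m \<le> n \<Longrightarrow> Y \<in> borel_measurable (F m) \<Longrightarrow> Y \<in> borel_measurable (F n)"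
  using sets_F_mono [of m n] by (auto simp: measurable_def space_F)

lemma borel_measurable_F: "Y \<in> borel_measurable (F n) \<Longrightarrow> Y \<in> borel_measurable M"
  using subalg by (rule measurable_from_subalg)

lemma finite_measure_subalgebra_F: "finite_measure_subalgebra M (F n)"
  by unfold_locales (rule subalg)

lemma stay_event_sets:
  assumes "U \<in> sets borel"
  shows "stay_event M X U n \<in> sets (F n)"
proof -
  have "stay_event M X U n = (\<Inter>i\<in>{..n}. X i -` U \<inter> space (F n))"
    by (auto simp: stay_event_def space_F)
  also have "\<dots> \<in> sets (F n)"
    using assms borel_measurable_filtration [OF _ X_adapted]
    by (intro sets.finite_INT measurable_sets) auto
  finally show ?thesis .
qed

lemma stay_event_sets_M: "U \<in> sets borel \<Longrightarrow> stay_event M X U n \<in> sets M"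
  using stay_event_sets [of U n] subalg [of n] by (auto simp: subalgebra_def)

lemma square_integrable_D: "square_integrable M (D (Suc n))"
  using D_L2 borel_measurable_F [OF D_adapted] by (simp add: square_integrable_def)

text \<open>The recursions are coupled, hence the joint induction: the new velocity involves the old
  position through the gradient, which has linear growth, and the new position involves the new
  velocity.\<close>

lemma square_integrable_XV: "square_integrable M (X n) \<and> square_integrable M (V n)"
proof (induction n)
  case 0
  show ?case
    using X0_L2 V0_L2 borel_measurable_F [OF X_adapted] borel_measurable_F [OF V_adapted]
    by (simp add: square_integrable_def)
next
  case (Suc n)
  have V: "square_integrable M (V (Suc n))"
    by (rule square_integrable_cong_AE [OF _ borel_measurable_F [OF V_adapted] V_step])
      (intro square_integrable_add square_integrable_diff square_integrable_scaleR
        square_integrable_D square_integrable_lipschitz [OF _ lipschitz_gradient]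
        conjunct1 [OF Suc] conjunct2 [OF Suc])
  have "square_integrable M (X (Suc n))"
    by (rule square_integrable_cong_AE [OF _ borel_measurable_F [OF X_adapted] X_step])
      (intro square_integrable_add square_integrable_scaleR V conjunct1 [OF Suc])
  with V show ?case by simp
qed

lemmas square_integrable_X = square_integrable_XV [THEN conjunct1]
  and square_integrable_V = square_integrable_XV [THEN conjunct2]

lemma square_integrable_gX: "square_integrable M (\<lambda>\<omega>. g (X n \<omega>))"
  using square_integrable_X lipschitz_gradient by (rule square_integrable_lipschitz)

text \<open>The descent lemma at the origin bounds the nonnegative f by a quadratic function of the
  position.\<close>

lemma integrable_fX: "integrable M (\<lambda>\<omega>. f (X n \<omega>))"
proof (rule Bochner_Integration.integrable_bound)
  show "integrable M (\<lambda>\<omega>. f 0 + inner (g 0) (X n \<omega>) + C\<^sub>L / 2 * (norm (X n \<omega>))\<^sup>2)"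
    using square_integrable_inner [OF square_integrable_const square_integrable_X]
      square_integrable_X [of n]
    by (auto simp: square_integrable_def)
  have "f \<in> borel_measurable borel"
    using continuous_f by (rule borel_measurable_continuous_onI)
  then show "(\<lambda>\<omega>. f (X n \<omega>)) \<in> borel_measurable M"
    using borel_measurable_F [OF X_adapted] by simp
  have "norm (f x) \<le> norm (f 0 + inner (g 0) x + C\<^sub>L / 2 * (norm x)\<^sup>2)" for x
    using descent_lemma [OF gradient lipschitz_gradient, of 0 x] f_nonneg [of x]
    by simp
  then show "AE \<omega> in M. norm (f (X n \<omega>))
      \<le> norm (f 0 + inner (g 0) (X n \<omega>) + C\<^sub>L / 2 * (norm (X n \<omega>))\<^sup>2)"
    by simp
qed

section \<open>Conditioning of the noise\<close>

text \<open>Each coordinate of \<open>Z\<close> is known at time n, so the matching noise coordinate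
  may be replaced by its conditional expectation, which vanishes. Square integrability of both
  factors makes every product integrable.\<close>

lemma noise_orthogonal:
  assumes Z: "square_integrable M Z" and meas: "Z \<in> borel_measurable (F n)"
  shows "(\<integral>\<omega>. inner (Z \<omega>) (D (Suc n) \<omega>) \<partial>M) = 0"
proof -
  interpret cond: finite_measure_subalgebra M "F n"
    by (rule finite_measure_subalgebra_F)
  have comp: "integrable M (\<lambda>\<omega>. Z \<omega> $ i * D (Suc n) \<omega> $ i)" for i
  proof (rule Bochner_Integration.integrable_bound)
    show "integrable M (\<lambda>\<omega>. (norm (Z \<omega>))\<^sup>2 + (norm (D (Suc n) \<omega>))\<^sup>2)"
      using Z square_integrable_D by (simp add: square_integrable_def)
    show "(\<lambda>\<omega>. Z \<omega> $ i * D (Suc n) \<omega> $ i) \<in> borel_measurable M"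
      using Z square_integrable_D [of n]
      by (intro borel_measurable_times measurable_compose [OF _ borel_measurable_nth])
        (auto simp: square_integrable_def)
    have "norm (z $ i * y $ i) \<le> norm ((norm z)\<^sup>2 + (norm y)\<^sup>2)" for z y :: "real ^ 'd"
    proof -
      have "\<bar>z $ i\<bar> * \<bar>y $ i\<bar> \<le> norm z * norm y"
        by (intro mult_mono component_le_norm_cart) auto
      moreover have "norm z * norm y \<le> (norm z)\<^sup>2 + (norm y)\<^sup>2"
        using sum_squares_bound [of "norm z" "norm y"]
          mult_nonneg_nonneg [OF norm_ge_zero [of z] norm_ge_zero [of y]]
        by linarith
      ultimately show ?thesis by (simp add: abs_mult)
    qed
    then show "AE \<omega> in M. norm (Z \<omega> $ i * D (Suc n) \<omega> $ i)
        \<le> norm ((norm (Z \<omega>))\<^sup>2 + (norm (D (Suc n) \<omega>))\<^sup>2)"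
      by simp
  qed
  have "(\<integral>\<omega>. Z \<omega> $ i * D (Suc n) \<omega> $ i \<partial>M) = 0" for i
  proof -
    have "(\<integral>\<omega>. Z \<omega> $ i * D (Suc n) \<omega> $ i \<partial>M)
        = (\<integral>\<omega>. Z \<omega> $ i * real_cond_exp M (F n) (\<lambda>\<omega>. D (Suc n) \<omega> $ i) \<omega> \<partial>M)"
      using comp meas borel_measurable_F [OF D_adapted]
      by (intro cond.real_cond_exp_intg(2) [symmetric] measurable_compose [OF _ borel_measurable_nth]) auto
    also have "\<dots> = 0"
      using D_martingale_difference [of n i] by (intro integral_eq_zero_AE) auto
    finally show ?thesis .
  qed
  then show ?thesis
    using comp by (simp add: inner_vec_def)
qed

text \<open>The stay event belongs to \<open>F n\<close>, so its indicator passes through the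
  conditional expectation and the noise bound is invoked only on that event.\<close>

lemma noise_energy:
  assumes U: "U \<in> sets borel"
    and noise_bound: "AE \<omega> in M. \<omega> \<in> stay_event M X U n \<longrightarrow>
      real_cond_exp M (F n) (\<lambda>\<omega>. (norm (D (Suc n) \<omega>))\<^sup>2) \<omega> \<le> \<sigma> * f (X n \<omega>)"
  defines "A \<equiv> stay_event M X U n"
  shows "(\<integral>\<omega>. indicator A \<omega> * (norm (D (Suc n) \<omega>))\<^sup>2 \<partial>M)
    \<le> \<sigma> * (\<integral>\<omega>. indicator A \<omega> * f (X n \<omega>) \<partial>M)"
proof -
  interpret cond: finite_measure_subalgebra M "F n"
    by (rule finite_measure_subalgebra_F)
  have A: "A \<in> sets M" "A \<in> sets (F n)"
    using U by (auto simp: A_def stay_event_sets stay_event_sets_M)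
  have int: "integrable M (\<lambda>\<omega>. indicator A \<omega> * (norm (D (Suc n) \<omega>))\<^sup>2)"
    using integrable_mult_indicator [OF A(1) D_L2] by simp
  have meas: "indicator A \<in> borel_measurable (F n)"
    "(\<lambda>\<omega>. (norm (D (Suc n) \<omega>))\<^sup>2) \<in> borel_measurable M"
    using A borel_measurable_F [OF D_adapted] by auto
  have "(\<integral>\<omega>. indicator A \<omega> * (norm (D (Suc n) \<omega>))\<^sup>2 \<partial>M)
      = (\<integral>\<omega>. indicator A \<omega> * real_cond_exp M (F n) (\<lambda>\<omega>. (norm (D (Suc n) \<omega>))\<^sup>2) \<omega> \<partial>M)"
    using cond.real_cond_exp_intg(2) [OF int meas] by simp
  also have "\<dots> \<le> (\<integral>\<omega>. \<sigma> * (indicator A \<omega> * f (X n \<omega>)) \<partial>M)"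
  proof (rule integral_mono_AE)
    show "integrable M (\<lambda>\<omega>. indicator A \<omega> * real_cond_exp M (F n) (\<lambda>\<omega>. (norm (D (Suc n) \<omega>))\<^sup>2) \<omega>)"
      using cond.real_cond_exp_intg(1) [OF int meas] .
    show "integrable M (\<lambda>\<omega>. \<sigma> * (indicator A \<omega> * f (X n \<omega>)))"
      using integrable_mult_indicator [OF A(1) integrable_fX [of n]] by simp
    show "AE \<omega> in M. indicator A \<omega> * real_cond_exp M (F n) (\<lambda>\<omega>. (norm (D (Suc n) \<omega>))\<^sup>2) \<omega>
        \<le> \<sigma> * (indicator A \<omega> * f (X n \<omega>))"
      using noise_bound by eventually_elim (auto simp: A_def indicator_def)
  qed
  finally show ?thesis by simp
qed

section \<open>Recursions for the energy and the objective\<close>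

definition energy :: "real \<Rightarrow> real \<Rightarrow> nat \<Rightarrow> 'a \<Rightarrow> real" where
  "energy a b n \<omega> = a * f (X n \<omega>) + inner (g (X n \<omega>)) (V n \<omega>) + b / 2 * (norm (V n \<omega>))\<^sup>2"

lemma integrable_energy: "integrable M (energy a b n)"
  unfolding energy_def [abs_def]
  using integrable_fX square_integrable_inner [OF square_integrable_gX square_integrable_V]
    square_integrable_V [of n]
  by (auto simp: square_integrable_def)


text \<open>The pathwise expansion is integrated over \<open>A\<close>. Since \<open>A\<close> lies
  in \<open>F n\<close>, the linear noise term still has mean zero after restriction; on
  \<open>A\<close> the gradient inequality holds at \<open>X n\<close>, as
  \<open>energy_drift\<close> requires. The event is the same on both sides, its index being shifted
  only later.\<close>

lemma energy_contraction:
  assumes U: "U \<in> sets borel"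
    and h: "\<gamma> (Suc n) = h"
    and a: "0 \<le> a" and b: "0 \<le> b"
    and gradient_inequality: "\<And>x. x \<in> U \<Longrightarrow> 2 * L * f x \<le> (norm (g x))\<^sup>2"
    and noise_bound: "AE \<omega> in M. \<omega> \<in> stay_event M X U n \<longrightarrow>
      real_cond_exp M (F n) (\<lambda>\<omega>. (norm (D (Suc n) \<omega>))\<^sup>2) \<omega> \<le> \<sigma> * f (X n \<omega>)"
    and cond1: "0 \<ge> - 1 + h * (b / 2 - a) + h^2 * C\<^sub>L + h^3 * (C\<^sub>L * a / 2)"
    and cond2: "0 \<ge> a * \<mu> + a * b - a^2 - 2 * L
      + h * (b * \<sigma> / 2 + a * (2 * C\<^sub>L - \<mu> * b + \<mu> * a) - 2 * L * (a - b / 2))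
      + h^2 * C\<^sub>L * (\<sigma> + a^2 - 2 * a * \<mu> + 2 * L)
      + h^3 * C\<^sub>L * a * (\<sigma> / 2 - a * \<mu> + L)"
    and cond3: "0 \<ge> C\<^sub>L - b / 2 * (\<mu> + a - b)
      + h * (b * \<mu>^2 / 2 + C\<^sub>L * a / 2 - 2 * C\<^sub>L * \<mu> + b * a * \<mu> / 2 - b^2 * \<mu> / 2 + C\<^sub>L * b)
      + h^2 * C\<^sub>L * (\<mu>^2 - a * \<mu> + b * a / 2 - b * \<mu>)
      + h^3 * (C\<^sub>L * a * \<mu> / 2) * (\<mu> - b)"
    and delta: "\<delta> = 1 + h * (a - \<mu> - b) + h^2 * (b * \<mu> - a * \<mu> - 2 * C\<^sub>L)
      + h^3 * (2 * C\<^sub>L * \<mu> - C\<^sub>L * a) + h^4 * C\<^sub>L * a * \<mu>"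
  defines "A \<equiv> stay_event M X U n"
  shows "(\<integral>\<omega>. indicator A \<omega> * energy a b (Suc n) \<omega> \<partial>M) \<le> \<delta> * (\<integral>\<omega>. indicator A \<omega> * energy a b n \<omega> \<partial>M)"
proof -
  have h_pos: "0 < h" using step_pos [of n] h by simp
  define \<kappa> where "\<kappa> = b / 2 + C\<^sub>L * h + a * C\<^sub>L * h\<^sup>2 / 2"
  have \<kappa>: "0 \<le> \<kappa>"
    using a b h_pos lipschitz_const_nonneg by (simp add: \<kappa>_def)
  \<comment> \<open>Here \<open>m\<close> is the conditional mean of the new velocity given
    \<open>F n\<close>, \<open>Z\<close> is the factor of the noise in the linear term, and
    \<open>G\<close> is the noise-free part of the expansion.\<close>
  define m where "m \<omega> = (1 - h * \<mu>) *\<^sub>R V n \<omega> - h *\<^sub>R g (X n \<omega>)" for \<omega>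
  define Z where "Z \<omega> = ((1 + a * h) * h) *\<^sub>R g (X n \<omega>) + (2 * \<kappa> * h) *\<^sub>R m \<omega>" for \<omega>
  define G where "G \<omega> = a * f (X n \<omega>) + (1 + a * h) * inner (g (X n \<omega>)) (m \<omega>) + \<kappa> * (norm (m \<omega>))\<^sup>2" for \<omega>
  have A: "A \<in> sets M" "A \<in> sets (F n)"
    using U by (auto simp: A_def stay_event_sets stay_event_sets_M)
  have int_A: "integrable M (\<lambda>\<omega>. indicator A \<omega> * Y \<omega>)" if "integrable M Y" for Y :: "'a \<Rightarrow> real"
    using integrable_mult_indicator [OF A(1) that] by simp
  have m: "square_integrable M m"
    unfolding m_def [abs_def]
    by (intro square_integrable_diff square_integrable_scaleR square_integrable_V square_integrable_gX)
  have Z: "square_integrable M Z"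
    unfolding Z_def [abs_def]
    by (intro square_integrable_add square_integrable_scaleR square_integrable_gX m)
  have int_G: "integrable M G"
    unfolding G_def [abs_def]
    using integrable_fX square_integrable_inner [OF square_integrable_gX m] m
    by (auto simp: square_integrable_def)
  have int_ZD: "integrable M (\<lambda>\<omega>. indicator A \<omega> * inner (Z \<omega>) (D (Suc n) \<omega>))"
    by (intro int_A square_integrable_inner Z square_integrable_D)
  have ZD: "(\<integral>\<omega>. indicator A \<omega> * inner (Z \<omega>) (D (Suc n) \<omega>) \<partial>M) = 0"
  proof -
    have "g \<in> borel_measurable borel"
      using continuous_g by (rule borel_measurable_continuous_onI)
    then have "Z \<in> borel_measurable (F n)"
      unfolding Z_def [abs_def] m_def using X_adapted [of n] V_adapted [of n] by simp
    then have "(\<lambda>\<omega>. indicator A \<omega> *\<^sub>R Z \<omega>) \<in> borel_measurable (F n)"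
      using A(2) by simp
    from noise_orthogonal [OF square_integrable_indicator [OF Z A(1)] this]
    show ?thesis by simp
  qed
  have "(\<integral>\<omega>. indicator A \<omega> * energy a b (Suc n) \<omega> \<partial>M)
    \<le> (\<integral>\<omega>. indicator A \<omega> * G \<omega> + indicator A \<omega> * inner (Z \<omega>) (D (Suc n) \<omega>)
        + \<kappa> * h\<^sup>2 * (indicator A \<omega> * (norm (D (Suc n) \<omega>))\<^sup>2) \<partial>M)"
  proof (rule integral_mono_AE)
    show "integrable M (\<lambda>\<omega>. indicator A \<omega> * energy a b (Suc n) \<omega>)"
      by (intro int_A integrable_energy)
    show "integrable M (\<lambda>\<omega>. indicator A \<omega> * G \<omega> + indicator A \<omega> * inner (Z \<omega>) (D (Suc n) \<omega>)
        + \<kappa> * h\<^sup>2 * (indicator A \<omega> * (norm (D (Suc n) \<omega>))\<^sup>2))"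
      by (intro Bochner_Integration.integrable_add integrable_mult_right int_ZD int_A int_G D_L2)
    show "AE \<omega> in M. indicator A \<omega> * energy a b (Suc n) \<omega>
      \<le> indicator A \<omega> * G \<omega> + indicator A \<omega> * inner (Z \<omega>) (D (Suc n) \<omega>)
        + \<kappa> * h\<^sup>2 * (indicator A \<omega> * (norm (D (Suc n) \<omega>))\<^sup>2)"
      using X_step [of n] V_step [of n]
    proof eventually_elim
      case (elim \<omega>)
      have V': "V (Suc n) \<omega> = m \<omega> + h *\<^sub>R D (Suc n) \<omega>"
        using elim(2) by (simp add: h m_def scaleR_diff_left)
      have X': "X (Suc n) \<omega> = X n \<omega> + h *\<^sub>R (m \<omega> + h *\<^sub>R D (Suc n) \<omega>)"
        using elim(1) by (simp add: h V')
      have "energy a b (Suc n) \<omega> \<le> G \<omega> + inner (Z \<omega>) (D (Suc n) \<omega>) + \<kappa> * h\<^sup>2 * (norm (D (Suc n) \<omega>))\<^sup>2"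
        using energy_step_pointwise [OF gradient lipschitz_gradient a less_imp_le [OF h_pos],
            of "X n \<omega>" "m \<omega>" "D (Suc n) \<omega>" b]
        unfolding energy_def V' X' G_def Z_def \<kappa>_def .
      then show ?case by (simp add: indicator_def)
    qed
  qed
  also have "\<dots> = (\<integral>\<omega>. indicator A \<omega> * G \<omega> \<partial>M)
      + \<kappa> * h\<^sup>2 * (\<integral>\<omega>. indicator A \<omega> * (norm (D (Suc n) \<omega>))\<^sup>2 \<partial>M)"
    using int_ZD int_A [OF int_G] int_A [OF D_L2 [of n]] by (simp add: ZD)
  also have "\<dots> \<le> (\<integral>\<omega>. indicator A \<omega> * G \<omega> \<partial>M)
      + \<kappa> * h\<^sup>2 * (\<sigma> * (\<integral>\<omega>. indicator A \<omega> * f (X n \<omega>) \<partial>M))"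
    using noise_energy [OF U noise_bound] \<kappa> by (intro add_left_mono mult_left_mono) (auto simp: A_def)
  also have "\<dots> = (\<integral>\<omega>. indicator A \<omega> * G \<omega> + \<kappa> * h\<^sup>2 * (\<sigma> * (indicator A \<omega> * f (X n \<omega>))) \<partial>M)"
    using int_A [OF int_G] int_A [OF integrable_fX [of n]] by simp
  also have "\<dots> \<le> (\<integral>\<omega>. \<delta> * (indicator A \<omega> * energy a b n \<omega>) \<partial>M)"
  proof (rule integral_mono)
    fix \<omega>
    have "G \<omega> + \<kappa> * h\<^sup>2 * (\<sigma> * f (X n \<omega>)) \<le> \<delta> * energy a b n \<omega>" if "\<omega> \<in> A"
    proof -
      have "X n \<omega> \<in> U" using that by (simp add: A_def stay_event_def)
      from energy_drift [OF h_pos f_nonneg gradient_inequality [OF this] cond1 cond2 cond3 delta, of "V n \<omega>"]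
      show ?thesis
        unfolding energy_def G_def m_def \<kappa>_def .
    qed
    then show "indicator A \<omega> * G \<omega> + \<kappa> * h\<^sup>2 * (\<sigma> * (indicator A \<omega> * f (X n \<omega>)))
        \<le> \<delta> * (indicator A \<omega> * energy a b n \<omega>)"
      by (simp add: indicator_def)
  qed (intro Bochner_Integration.integrable_add integrable_mult_right int_A int_G integrable_fX integrable_energy)+
  finally show ?thesis by simp
qed

lemma stay_event_Suc_subset: "stay_event M X U (Suc n) \<subseteq> stay_event M X U n"
  by (auto simp: stay_event_def)

lemma integrable_stay_event:
  assumes "U \<in> sets borel" "integrable M Y"
  shows "integrable M (\<lambda>\<omega>. indicator (stay_event M X U n) \<omega> * Y \<omega> :: real)"
  using integrable_mult_indicator [OF stay_event_sets_M [OF assms(1)] assms(2)] by simp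

text \<open>Stay events shrink with time, so a nonnegative integrand allows a bound to pass to the
  earlier event. Both recursions of the theorem shift their index in this way.\<close>

lemma integral_stay_event_Suc_le:
  assumes "U \<in> sets borel" "integrable M Y" "\<And>\<omega>. 0 \<le> Y \<omega>"
  shows "(\<integral>\<omega>. indicator (stay_event M X U (Suc n)) \<omega> * Y \<omega> \<partial>M)
    \<le> (\<integral>\<omega>. indicator (stay_event M X U n) \<omega> * Y \<omega> \<partial>M :: real)"
  using assms stay_event_Suc_subset [of U n]
  by (intro integral_mono integrable_stay_event mult_right_mono) (auto simp: indicator_def)

text \<open>The reverse descent lemma is used at the new iterate, reached by the displacement
  \<open>h *\<^sub>R v\<close>. The step bound turns the remainder into the kinetic term of
  \<open>h\<close> times the energy, and adding \<open>a * h * f x\<close> to both sides completes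
  that energy.\<close>

lemma objective_step:
  assumes h: "\<gamma> (Suc n) = h" and step_bound: "h * C\<^sub>L \<le> b"
  shows "AE \<omega> in M. (1 + a * h) * f (X (Suc n) \<omega>) \<le> f (X n \<omega>) + h * energy a b (Suc n) \<omega>"
  using X_step [of n]
proof eventually_elim
  case (elim \<omega>)
  define x v where "x = X (Suc n) \<omega>" and "v = V (Suc n) \<omega>"
  have h_pos: "0 < h" using step_pos [of n] h by simp
  have x: "x = X n \<omega> + h *\<^sub>R v" using elim by (simp add: h x_def v_def)
  have "f x \<le> f (X n \<omega>) + h * inner (g x) v + h * (h * C\<^sub>L) * ((norm v)\<^sup>2 / 2)"
    using descent_lemma_reverse [OF gradient lipschitz_gradient, of "X n \<omega>" "h *\<^sub>R v"]
    by (simp add: x [symmetric] power_mult_distrib power2_eq_square mult_ac)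
  also have "\<dots> \<le> f (X n \<omega>) + h * inner (g x) v + h * b * ((norm v)\<^sup>2 / 2)"
    using step_bound h_pos by (intro add_left_mono mult_right_mono mult_left_mono) auto
  finally show ?case
    by (simp add: energy_def x_def [symmetric] v_def [symmetric] algebra_simps)
qed

end

section \<open>Combination of the two recursions\<close>

theorem theorem3p4:
  fixes M :: "'a measure" and F :: "nat \<Rightarrow> 'a measure"
    and f :: "real ^ 'd \<Rightarrow> real" and g :: "real ^ 'd \<Rightarrow> real ^ 'd"
    and C\<^sub>L \<mu> \<gamma> L \<sigma> a b \<delta> :: real
    and X V D :: "nat \<Rightarrow> 'a \<Rightarrow> real ^ 'd"
    and U :: "(real ^ 'd) set"
  assumes msgd: "msgd M F f g C\<^sub>L \<mu> (\<lambda>_. \<gamma>) X V D"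
    and gamma_pos: "\<gamma> > 0"
    and L_pos: "L > 0"
    and sigma_nonneg: "\<sigma> \<ge> 0"
    and open_U: "open U"
    and gradient_inequality: "\<And>x. x \<in> U \<Longrightarrow> (norm (g x))\<^sup>2 \<ge> 2 * L * f x"
    and noise_bound: "\<And>n. AE \<omega> in M. \<omega> \<in> stay_event M X U n \<longrightarrow>
      real_cond_exp M (F n) (\<lambda>\<omega>. (norm (D (Suc n) \<omega>))\<^sup>2) \<omega> \<le> \<sigma> * f (X n \<omega>)"
    and a_nonneg: "a \<ge> 0"
    and b_nonneg: "b \<ge> 0"
    and cond1: "0 \<ge> - 1 + \<gamma> * (b / 2 - a) + \<gamma>^2 * C\<^sub>L + \<gamma>^3 * (C\<^sub>L * a / 2)"
    and cond2: "0 \<ge> a * \<mu> + a * b - a^2 - 2 * L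
      + \<gamma> * (b * \<sigma> / 2 + a * (2 * C\<^sub>L - \<mu> * b + \<mu> * a) - 2 * L * (a - b / 2))
      + \<gamma>^2 * C\<^sub>L * (\<sigma> + a^2 - 2 * a * \<mu> + 2 * L)
      + \<gamma>^3 * C\<^sub>L * a * (\<sigma> / 2 - a * \<mu> + L)"
    and cond3: "0 \<ge> C\<^sub>L - b / 2 * (\<mu> + a - b)
      + \<gamma> * (b * \<mu>^2 / 2 + C\<^sub>L * a / 2 - 2 * C\<^sub>L * \<mu> + b * a * \<mu> / 2 - b^2 * \<mu> / 2 + C\<^sub>L * b)
      + \<gamma>^2 * C\<^sub>L * (\<mu>^2 - a * \<mu> + b * a / 2 - b * \<mu>)
      + \<gamma>^3 * (C\<^sub>L * a * \<mu> / 2) * (\<mu> - b)"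
    and delta: "\<delta> = 1 + \<gamma> * (a - \<mu> - b) + \<gamma>^2 * (b * \<mu> - a * \<mu> - 2 * C\<^sub>L)
      + \<gamma>^3 * (2 * C\<^sub>L * \<mu> - C\<^sub>L * a) + \<gamma>^4 * C\<^sub>L * a * \<mu>"
    and delta_nonneg: "0 \<le> \<delta>"
    and ab: "a * b \<ge> C\<^sub>L"
    and step_bound: "\<gamma> * C\<^sub>L \<le> b"
  shows "\<exists>C\<ge>0. \<forall>n\<ge>1.
    integrable M (\<lambda>\<omega>. indicator (stay_event M X U (n - 1)) \<omega> * f (X n \<omega>)) \<and>
    (let E = prob_space.expectation M
               (\<lambda>\<omega>. indicator (stay_event M X U (n - 1)) \<omega> * f (X n \<omega>))
     in (ereal (1 + a * \<gamma>) < inverse (ereal \<delta>) \<longrightarrow> E \<le> C / (1 + a * \<gamma>) ^ n) \<and>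
        (ereal (1 + a * \<gamma>) > inverse (ereal \<delta>) \<longrightarrow> E \<le> C * \<delta> ^ n) \<and>
        (ereal (1 + a * \<gamma>) = inverse (ereal \<delta>) \<longrightarrow> E \<le> C / (1 + a * \<gamma>) ^ n * real n))"
proof -
  interpret msgd M F f g C\<^sub>L \<mu> "\<lambda>_. \<gamma>" X V D by (rule msgd)
  have U: "U \<in> sets borel" using open_U by simp
  define A where "A n = stay_event M X U n" for n
  \<comment> \<open>The event lags one step behind the iterate. At n = 0 the subtraction on natural
    numbers gives \<open>A 0\<close>; the recursions below start at n = 1.\<close>
  define u where "u n = (\<integral>\<omega>. indicator (A (n - 1)) \<omega> * f (X n \<omega>) \<partial>M)" for n
  define R where "R n = (\<integral>\<omega>. indicator (A (n - 1)) \<omega> * energy a b n \<omega> \<partial>M)" for n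
  define q where "q = 1 / (1 + a * \<gamma>)"
  have denom: "0 < 1 + a * \<gamma>" using a_nonneg gamma_pos by (simp add: add_pos_nonneg)
  have q: "0 < q" using denom by (simp add: q_def)
  have energy_pos: "0 \<le> energy a b n \<omega>" for n \<omega>
    unfolding energy_def
    by (rule energy_nonneg [OF gradient lipschitz_gradient f_nonneg a_nonneg b_nonneg ab])
  have R_nonneg: "0 \<le> R n" and u_nonneg: "0 \<le> u n" for n
    using energy_pos f_nonneg by (auto simp: R_def u_def intro!: Bochner_Integration.integral_nonneg)
  have R_step: "R (Suc (Suc n)) \<le> \<delta> * R (Suc n)" for n
  proof -
    have "R (Suc (Suc n)) \<le> \<delta> * (\<integral>\<omega>. indicator (A (Suc n)) \<omega> * energy a b (Suc n) \<omega> \<partial>M)"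
      using energy_contraction [OF U refl a_nonneg b_nonneg gradient_inequality noise_bound
          cond1 cond2 cond3 delta]
      by (simp add: R_def A_def)
    \<comment> \<open>The contraction ends with the event \<open>A (Suc n)\<close>, while
      \<open>R (Suc n)\<close> carries the larger \<open>A n\<close>. The enlargement relies on a
      nonnegative energy and \<delta> \<ge> 0.\<close>
    also have "\<dots> \<le> \<delta> * R (Suc n)"
      using integral_stay_event_Suc_le [OF U integrable_energy energy_pos] delta_nonneg
      by (simp add: R_def A_def mult_left_mono)
    finally show ?thesis .
  qed
  have R_bound: "R (Suc n) \<le> \<delta> ^ n * R 1" for n
  proof (induction n)
    case (Suc n)
    have "R (Suc (Suc n)) \<le> \<delta> * R (Suc n)" by (rule R_step)
    also have "\<dots> \<le> \<delta> * (\<delta> ^ n * R 1)" using Suc delta_nonneg by (rule mult_left_mono)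
    finally show ?case by (simp add: mult_ac)
  qed simp
  \<comment> \<open>The energy of the new iterate enters, and \<open>R (Suc n)\<close> is at most
    \<open>\<delta> ^ n * R 1\<close>; hence the perturbation constant
    \<open>\<gamma> * R 1\<close>.\<close>
  have u_step: "u (Suc n) \<le> q * (u n + \<gamma> * R 1 * \<delta> ^ n)" if "n \<ge> 1" for n
  proof -
    obtain k where k: "n = Suc k" using \<open>n \<ge> 1\<close> by (cases n) auto
    have int: "integrable M (\<lambda>\<omega>. indicator (A n) \<omega> * f (X k \<omega>))"
      "integrable M (\<lambda>\<omega>. indicator (A n) \<omega> * energy a b k \<omega>)" for n k
      unfolding A_def by (intro integrable_stay_event U integrable_fX integrable_energy)+
    have "(1 + a * \<gamma>) * u (Suc n) = (\<integral>\<omega>. (1 + a * \<gamma>) * (indicator (A n) \<omega> * f (X (Suc n) \<omega>)) \<partial>M)"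
      by (simp add: u_def)
    also have "\<dots> \<le> (\<integral>\<omega>. indicator (A n) \<omega> * f (X n \<omega>) + \<gamma> * (indicator (A n) \<omega> * energy a b (Suc n) \<omega>) \<partial>M)"
    proof (rule integral_mono_AE)
      show "AE \<omega> in M. (1 + a * \<gamma>) * (indicator (A n) \<omega> * f (X (Suc n) \<omega>))
          \<le> indicator (A n) \<omega> * f (X n \<omega>) + \<gamma> * (indicator (A n) \<omega> * energy a b (Suc n) \<omega>)"
        using objective_step [OF refl step_bound, where n = n and a = a]
        by eventually_elim (simp add: indicator_def)
    qed (intro Bochner_Integration.integrable_add integrable_mult_right int)+
    also have "\<dots> = (\<integral>\<omega>. indicator (A n) \<omega> * f (X n \<omega>) \<partial>M) + \<gamma> * R (Suc n)"
      using int by (simp add: R_def)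
    also have "\<dots> \<le> u n + \<gamma> * (\<delta> ^ n * R 1)"
      using integral_stay_event_Suc_le [OF U integrable_fX f_nonneg] R_bound [of n] gamma_pos
      by (intro add_mono mult_left_mono) (auto simp: u_def A_def k)
    finally show ?thesis using denom by (simp add: q_def field_simps)
  qed
  from perturbed_geometric_decay [OF q delta_nonneg _ u_nonneg u_step] R_nonneg gamma_pos
  obtain C where C: "0 \<le> C" and decay: "\<And>n. n \<ge> 1 \<Longrightarrow> (\<delta> < q \<longrightarrow> u n \<le> C * q ^ n)
      \<and> (q < \<delta> \<longrightarrow> u n \<le> C * \<delta> ^ n) \<and> (\<delta> = q \<longrightarrow> u n \<le> C * q ^ n * real n)"
    by (metis less_imp_le mult_nonneg_nonneg)
  have q_power: "C * q ^ n = C / (1 + a * \<gamma>) ^ n" for n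
    by (simp add: q_def power_divide)
  \<comment> \<open>In the extended reals the inverse of 0 is infinite, so \<delta> = 0 falls under
    the first case, in agreement with \<delta> < q. For positive \<delta> the equivalences follow by
    taking reciprocals.\<close>
  have cases: "ereal (1 + a * \<gamma>) < inverse (ereal \<delta>) \<longleftrightarrow> \<delta> < q"
    "ereal (1 + a * \<gamma>) > inverse (ereal \<delta>) \<longleftrightarrow> q < \<delta>"
    "ereal (1 + a * \<gamma>) = inverse (ereal \<delta>) \<longleftrightarrow> \<delta> = q"
    using denom delta_nonneg q by (auto simp: q_def field_simps)
  show ?thesis
  proof (intro exI [of _ C] conjI allI impI)
    fix n :: nat assume n: "1 \<le> n"
    show "integrable M (\<lambda>\<omega>. indicator (stay_event M X U (n - 1)) \<omega> * f (X n \<omega>))"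
      by (intro integrable_stay_event U integrable_fX)
    show "let E = expectation (\<lambda>\<omega>. indicator (stay_event M X U (n - 1)) \<omega> * f (X n \<omega>))
      in (ereal (1 + a * \<gamma>) < inverse (ereal \<delta>) \<longrightarrow> E \<le> C / (1 + a * \<gamma>) ^ n) \<and>
         (ereal (1 + a * \<gamma>) > inverse (ereal \<delta>) \<longrightarrow> E \<le> C * \<delta> ^ n) \<and>
         (ereal (1 + a * \<gamma>) = inverse (ereal \<delta>) \<longrightarrow> E \<le> C / (1 + a * \<gamma>) ^ n * real n)"
      using decay [OF n] unfolding cases Let_def q_power [symmetric] u_def A_def .
  qed (rule C)
qed

end
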